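(* Let $G=(V,E)$ be a finite simple graph, fix a linear ordering of $V$, and let $\pi:\mathcal{A}(G)\to L_G$ be the sink-component map with respect to this ordering. Then $$A_G(V)=\sum_{\mathfrak{o}\in\mathcal{A}(G)}\ \prod_{B\in\pi(\mathfrak{o})}v_B .$$
   Context: An orientation of $G$ assigns a direction to each edge; it is acyclic if it has no directed cycles. $\mathcal{A}(G)$ is the set of acyclic orientations of $G$. For $\mathfrak{o}\in\mathcal{A}(G)$, a vertex $v$ is a sink if every edge incident with $v$ is directed toward $v$ (in particular, isolated vertices are sinks); $\operatorname{Sink}(\mathfrak{o})$ is the set of sinks of $\mathfrak{o}$. To each vertex $v\in V$ associate a commuting variable, also denoted $v$, and let $\mathbb{Z}[V]$ be the polynomial ring in these variables. The acyclic orientation polynomial of $G$ is $$A_G(V)=\sum_{\mathfrak{o}\in\mathcal{A}(G)}\ \prod_{v\in\operatorname{Sink}(\mathfrak{o})}v\ \in\mathbb{Z}[V].$$ A vertex partition is a set of mutually disjoint non-empty subsets of $V$ (called blocks) whose union is $V$. A bond is a vertex partition each of whose blocks induces a connected subgraph of $G$, and $L_G$ is the set of bonds of $G$. For a block $B\subseteq V$, put $v_B=1-\prod_{v\in B}(1-v)\in\mathbb{Z}[V]$. Sink-component map: fix a linear ordering of $V$ and let $\mathfrak{o}\in\mathcal{A}(G)$. For $j\ge 1$, suppose $B_1,\dots,B_{j-1}\subseteq V$ have been defined and do not cover $V$. Let $s_j$ be the smallest element of $V\setminus\bigcup_{i=1}^{j-1}B_i$, and let $B_j$ be the set of vertices in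 $V\setminus\bigcup_{i=1}^{j-1}B_i$ from which $s_j$ can be reached via a directed path in $\mathfrak{o}$ (including $s_j$ itself). The process stops when all of $V$ is covered, say after $q$ steps, and $\pi(\mathfrak{o})=\{B_1,\dots,B_q\}$, which is a bond of $G$. *)

theory Defs
  imports Main "HOL-Library.Poly_Mapping" "HOL-Library.Disjoint_Sets"
begin

section \<open>Simple graphs and acyclic orientations\<close>

definition simple_graph :: "'a set \<Rightarrow> 'a set set \<Rightarrow> bool" where
  "simple_graph V E \<longleftrightarrow> finite V \<and> (\<forall>e\<in>E. e \<subseteq> V \<and> card e = 2)"

text \<open>An orientation is the set of its arcs; \<open>(u, v) \<in> D\<close> says that the edge \<open>{u, v}\<close> is directed
  from \<open>u\<close> to \<open>v\<close>.\<close>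

definition orientation :: "'a set set \<Rightarrow> ('a \<times> 'a) set \<Rightarrow> bool" where
  "orientation E D \<longleftrightarrow>
     (\<forall>u v. (u, v) \<in> D \<longrightarrow> {u, v} \<in> E) \<and>
     (\<forall>u v. {u, v} \<in> E \<longrightarrow> ((u, v) \<in> D \<longleftrightarrow> (v, u) \<notin> D))"

definition acyclic_orientations :: "'a set set \<Rightarrow> ('a \<times> 'a) set set" where
  "acyclic_orientations E = {D. orientation E D \<and> acyclic D}"

definition sinks :: "'a set \<Rightarrow> 'a set set \<Rightarrow> ('a \<times> 'a) set \<Rightarrow> 'a set" where
  "sinks V E D = {v \<in> V. \<forall>u. {u, v} \<in> E \<longrightarrow> (u, v) \<in> D}"

section \<open>The acyclic orientation polynomial\<close>

text \<open>Integer polynomials in commuting variables indexed by \<open>'a\<close>, as finitely supported functions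
  from exponent vectors to coefficients. Everything below only involves the variables in \<open>V\<close>, that
  is, it lies in the subring \<open>\<int>[V]\<close>.\<close>

type_synonym 'a int_mpoly = "('a \<Rightarrow>\<^sub>0 nat) \<Rightarrow>\<^sub>0 int"

definition var :: "'a \<Rightarrow> 'a int_mpoly" where
  "var v = Poly_Mapping.single (Poly_Mapping.single v 1) 1"

definition acyclic_orientation_poly :: "'a set \<Rightarrow> 'a set set \<Rightarrow> 'a int_mpoly" where
  "acyclic_orientation_poly V E = (\<Sum>D\<in>acyclic_orientations E. \<Prod>v\<in>sinks V E D. var v)"

definition block_poly :: "'a set \<Rightarrow> 'a int_mpoly" where
  "block_poly B = 1 - (\<Prod>v\<in>B. 1 - var v)"

section \<open>Bonds and the sink-component map\<close>

definition induces_connected :: "'a set set \<Rightarrow> 'a set \<Rightarrow> bool" where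
  "induces_connected E B \<longleftrightarrow>
     (\<forall>u\<in>B. \<forall>v\<in>B. (u, v) \<in> {(x, y). x \<in> B \<and> y \<in> B \<and> {x, y} \<in> E}\<^sup>*)"

definition bonds :: "'a set \<Rightarrow> 'a set set \<Rightarrow> 'a set set set" where
  "bonds V E = {P. partition_on V P \<and> (\<forall>B\<in>P. induces_connected E B)}"

text \<open>The relation \<open>r\<close> is the linear ordering of the vertices, \<open>(x, y) \<in> r\<close> meaning \<open>x \<le> y\<close>.\<close>

definition least_vertex :: "('a \<times> 'a) set \<Rightarrow> 'a set \<Rightarrow> 'a" where
  "least_vertex r R = (THE s. s \<in> R \<and> (\<forall>x\<in>R. (s, x) \<in> r))"

text \<open>The block split off from the set \<open>R\<close> of vertices that are not yet covered.\<close>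

definition sink_component :: "('a \<times> 'a) set \<Rightarrow> ('a \<times> 'a) set \<Rightarrow> 'a set \<Rightarrow> 'a set" where
  "sink_component r D R = {v \<in> R. (v, least_vertex r R) \<in> D\<^sup>*}"

text \<open>The vertices not covered by the first \<open>j\<close> blocks; the process stops as soon as this is empty.\<close>

primrec uncovered :: "'a set \<Rightarrow> ('a \<times> 'a) set \<Rightarrow> ('a \<times> 'a) set \<Rightarrow> nat \<Rightarrow> 'a set" where
  "uncovered V r D 0 = V"
| "uncovered V r D (Suc j) = uncovered V r D j - sink_component r D (uncovered V r D j)"

definition sink_components :: "'a set \<Rightarrow> ('a \<times> 'a) set \<Rightarrow> ('a \<times> 'a) set \<Rightarrow> 'a set set" where
  "sink_components V r D =
     {sink_component r D (uncovered V r D j) | j. uncovered V r D j \<noteq> {}}"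

lemma least_vertex:
  assumes "finite V" "linear_order_on V r" "R \<subseteq> V" "R \<noteq> {}"
  shows "least_vertex r R \<in> R" "\<And>x. x \<in> R \<Longrightarrow> (least_vertex r R, x) \<in> r"
proof -
  have refl: "(x, x) \<in> r" if "x \<in> V" for x
    using assms(2) that by (auto simp: order_on_defs refl_on_def)
  have tr: "trans r" and anti: "antisym r" and tot: "total_on V r"
    using assms(2) by (auto simp: order_on_defs)
  have "finite R" using assms(1,3) by (rule rev_finite_subset)
  from this assms(4,3) have ex: "\<exists>s\<in>R. \<forall>x\<in>R. (s, x) \<in> r"
  proof (induction R rule: finite_ne_induct)
    case (singleton x)
    then show ?case using refl by auto
  next
    case (insert x F)
    then obtain s where s: "s \<in> F" "\<forall>y\<in>F. (s, y) \<in> r" by auto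
    have "s \<in> V" "x \<in> V" using s insert by auto
    then consider "(s, x) \<in> r" | "(x, s) \<in> r" using tot refl by (metis total_on_def)
    then show ?case
    proof cases
      case 1
      then show ?thesis using s by auto
    next
      case 2
      then have "\<forall>y\<in>F. (x, y) \<in> r" using s tr by (meson transD)
      then show ?thesis using refl \<open>x \<in> V\<close> by auto
    qed
  qed
  then have "\<exists>!s. s \<in> R \<and> (\<forall>x\<in>R. (s, x) \<in> r)"
    using anti by (auto dest: antisymD)
  from theI'[OF this] show "least_vertex r R \<in> R" "\<And>x. x \<in> R \<Longrightarrow> (least_vertex r R, x) \<in> r"
    by (auto simp: least_vertex_def)
qed

lemma sink_components_in_bonds:
  assumes G: "simple_graph V E" and r: "linear_order_on V r" and D: "D \<in> acyclic_orientations E"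
  shows "sink_components V r D \<in> bonds V E"
proof -
  let ?U = "uncovered V r D" and ?s = "\<lambda>j. least_vertex r (uncovered V r D j)"
  let ?B = "\<lambda>j. sink_component r D (uncovered V r D j)"
  have fin: "finite V" using G by (simp add: simple_graph_def)
  have DE: "{u, v} \<in> E" if "(u, v) \<in> D" for u v
    using D that by (auto simp: acyclic_orientations_def orientation_def)
  have DV: "v \<in> V" if "(u, v) \<in> D" for u v
    using DE[OF that] G by (auto simp: simple_graph_def)
  have sub: "?U j \<subseteq> V" for j by (induction j) auto
  have B_sub: "?B j \<subseteq> ?U j" for j by (auto simp: sink_component_def)
  have s_U: "?s j \<in> ?U j" if "?U j \<noteq> {}" for j
    using least_vertex(1)[OF fin r sub that] .
  have s_B: "?s j \<in> ?B j" if "?U j \<noteq> {}" for j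
    using s_U[OF that] by (simp add: sink_component_def)
  have anti: "?U j \<subseteq> ?U i" if "i \<le> j" for i j
    using that by (induction j rule: dec_induct) auto
  have card: "card (?U j) + j \<le> card V \<or> ?U j = {}" for j
  proof (induction j)
    case (Suc j)
    show ?case
    proof (cases "?U j = {}")
      case False
      have "finite (?U j)" using sub fin by (rule finite_subset)
      moreover have "?U (Suc j) \<subset> ?U j" using s_U[OF False] s_B[OF False] by auto
      ultimately have "card (?U (Suc j)) < card (?U j)" by (rule psubset_card_mono)
      then show ?thesis using Suc False by auto
    qed simp
  qed simp
  have "?U (Suc (card V)) = {}" using card[of "Suc (card V)"] by auto
  moreover have "v \<in> ?U j" if "v \<in> V" "\<And>i. ?U i \<noteq> {} \<Longrightarrow> v \<notin> ?B i" for v j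
    using that by (induction j) auto
  ultimately have cov: "\<exists>i. ?U i \<noteq> {} \<and> v \<in> ?B i" if "v \<in> V" for v
    using that by blast
  have cover: "\<Union>(sink_components V r D) = V"
  proof
    show "\<Union>(sink_components V r D) \<subseteq> V"
      using subset_trans[OF B_sub sub] by (auto simp: sink_components_def)
    show "V \<subseteq> \<Union>(sink_components V r D)"
    proof
      fix v assume "v \<in> V"
      then obtain i where i: "?U i \<noteq> {}" "v \<in> ?B i" using cov by metis
      then have "?B i \<in> sink_components V r D" by (auto simp: sink_components_def)
      then show "v \<in> \<Union>(sink_components V r D)" using i(2) by (rule UnionI)
    qed
  qed
  have disj: "?B i \<inter> ?B j = {}" if "i < j" for i j
    using anti[of "Suc i" j] B_sub[of j] that by auto
  have closed: "w \<in> ?U j" if "v \<in> ?U j" "(v, w) \<in> D" for v w j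
    using that
  proof (induction j)
    case 0
    then show ?case using DV by simp
  next
    case (Suc j)
    then show ?case by (auto simp: sink_component_def intro: converse_rtrancl_into_rtrancl)
  qed
  have conn: "induces_connected E (?B j)" for j
  proof -
    let ?A = "{(x, y). x \<in> ?B j \<and> y \<in> ?B j \<and> {x, y} \<in> E}"
    have "v \<in> ?U j \<longrightarrow> (v, ?s j) \<in> ?A\<^sup>*" if "(v, ?s j) \<in> D\<^sup>*" for v
      using that
    proof (induction rule: converse_rtrancl_induct)
      case (step y z)
      show ?case
      proof
        assume y: "y \<in> ?U j"
        have z: "z \<in> ?U j" using closed[OF y step(1)] .
        have "(y, ?s j) \<in> D\<^sup>*" using step by (meson converse_rtrancl_into_rtrancl)
        then have "(y, z) \<in> ?A" using y z step DE by (auto simp: sink_component_def)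
        then show "(y, ?s j) \<in> ?A\<^sup>*" using step(3) z by (meson converse_rtrancl_into_rtrancl)
      qed
    qed simp
    then have to_s: "(v, ?s j) \<in> ?A\<^sup>*" if "v \<in> ?B j" for v
      using that by (auto simp: sink_component_def)
    have "sym ?A" by (auto simp: sym_def insert_commute)
    then have "sym (?A\<^sup>*)" by (rule sym_rtrancl)
    then show ?thesis
      unfolding induces_connected_def using to_s by (meson rtrancl_trans symD)
  qed
  have "partition_on V (sink_components V r D)"
  proof (rule partition_onI[OF cover])
    fix p q assume "p \<in> sink_components V r D" "q \<in> sink_components V r D" "p \<noteq> q"
    then obtain i j where "p = ?B i" "q = ?B j" "i \<noteq> j" by (auto simp: sink_components_def)
    then show "disjnt p q" using disj[of i j] disj[of j i] by (auto simp: disjnt_def neq_iff)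
  next
    show "{} \<notin> sink_components V r D" using s_B by (fastforce simp: sink_components_def)
  qed
  then show ?thesis using conn by (auto simp: bonds_def sink_components_def)
qed

end

theory Submission
  imports Defs
begin

text \<open>
  Substitute \<open>v = 1 - w v\<close> and write \<open>*\<close> for subset convolution of set functions. Let \<open>a Y\<close> count the
  acyclic orientations of the subgraph induced by \<open>Y\<close>, let \<open>i S\<close> be \<open>(- 1) ^ card S\<close> on independent
  sets and 0 elsewhere, and let \<open>b Y\<close> count the acyclic orientations on \<open>Y\<close> in which every vertex
  reaches \<open>s\<close>. Expanding the product over the sinks shows that the acyclic orientation polynomial is
  \<open>A = (i w) * a\<close>, where \<open>i w\<close> stands for \<open>S \<mapsto> i S * prod w S\<close>. At \<open>w = 1\<close> this gives \<open>i * a = 1\<close>,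
  because a nonempty acyclic orientation has a sink. Splitting off the vertices that reach \<open>s\<close> gives
  \<open>b * a = \<delta> a\<close>, where \<open>\<delta>\<close> restricts a set function to the sets containing \<open>s\<close>. As \<open>\<delta>\<close> is a derivation
  of the convolution algebra, \<open>b * i = - \<delta> i\<close>, and therefore \<open>\<delta> A = (b (1 - w)) * A\<close>. Splitting off
  the first block shows that the sum over sink components satisfies the same recursion when \<open>s\<close> is the
  least vertex.
\<close>

section \<open>Subset convolution\<close>

text \<open>On finite sets this is multiplication in the polynomial ring modulo all squares of
  variables: \<open>f\<close> stands for the sum of \<open>f X\<close> times the squarefree monomial
  of \<open>X\<close>. The unit is the indicator of the empty set.\<close>

definition subset_conv :: "('a set \<Rightarrow> 'b) \<Rightarrow> ('a set \<Rightarrow> 'b) \<Rightarrow> 'a set \<Rightarrow> 'b::comm_ring_1" where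
  "subset_conv f g X = (\<Sum>B\<in>Pow X. f B * g (X - B))"

text \<open>In the monomial picture this is the Euler operator of the variable \<open>s\<close>,
  differentiation followed by multiplication by that variable.\<close>

definition restrict_mem :: "'a \<Rightarrow> ('a set \<Rightarrow> 'b) \<Rightarrow> 'a set \<Rightarrow> 'b::comm_ring_1" where
  "restrict_mem s f X = (if s \<in> X then f X else 0)"

lemma subset_conv_cong:
  assumes "finite X" "\<And>Y. finite Y \<Longrightarrow> f Y = f' Y" "\<And>Y. finite Y \<Longrightarrow> g Y = g' Y"
  shows "subset_conv f g X = subset_conv f' g' X"
  unfolding subset_conv_def using assms by (intro sum.cong) (auto dest: finite_subset)

lemma subset_conv_commute: "subset_conv f g X = subset_conv g f X"
  unfolding subset_conv_def
  by (rule sum.reindex_bij_witness[where i="\<lambda>B. X - B" and j="\<lambda>B. X - B"])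
    (auto simp: double_diff mult.commute)

text \<open>Both sides run over the ordered decompositions of \<open>X\<close> into three disjoint
  sets. The reindexing trades a chain of subsets for its successive differences.\<close>

lemma subset_conv_assoc:
  assumes "finite X"
  shows "subset_conv (subset_conv f g) h X = subset_conv f (subset_conv g h) X"
proof -
  have "subset_conv (subset_conv f g) h X =
      (\<Sum>(C, B)\<in>(SIGMA C:Pow X. Pow C). f B * g (C - B) * h (X - C))"
    unfolding subset_conv_def sum_distrib_right using assms
    by (subst sum.Sigma) (auto dest: finite_subset)
  also have "\<dots> = (\<Sum>(B, C)\<in>(SIGMA B:Pow X. Pow (X - B)). f B * (g C * h (X - B - C)))"
    by (rule sum.reindex_bij_witness[where i="\<lambda>(B, C). (B \<union> C, B)" and j="\<lambda>(C, B). (B, C - B)"])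
      (auto simp: mult.assoc intro!: arg_cong2[where f="(*)"] arg_cong[where f=g] arg_cong[where f=h])
  also have "\<dots> = subset_conv f (subset_conv g h) X"
    unfolding subset_conv_def sum_distrib_left using assms
    by (subst sum.Sigma) (auto dest: finite_subset)
  finally show ?thesis .
qed

lemma subset_conv_one_right:
  assumes "finite X"
  shows "subset_conv f (\<lambda>Y. if Y = {} then 1 else 0) X = f X"
proof -
  have "subset_conv f (\<lambda>Y. if Y = {} then 1 else 0) X = (\<Sum>B\<in>Pow X. if B = X then f B else 0)"
    unfolding subset_conv_def by (intro sum.cong) auto
  then show ?thesis using assms by simp
qed

lemma subset_conv_uminus_left: "subset_conv (\<lambda>Y. - f Y) g X = - subset_conv f g X"
  by (simp add: subset_conv_def sum_negf)

lemma subset_conv_diff_left: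
  "subset_conv (\<lambda>Y. f Y - f' Y) g X = subset_conv f g X - subset_conv f' g X"
  by (simp add: subset_conv_def sum_subtractf algebra_simps)

text \<open>\<open>prod w\<close> is multiplicative over disjoint unions, so weighting by it
  respects convolution. It amounts to rescaling each variable \<open>v\<close> by
  \<open>w v\<close>.\<close>

lemma subset_conv_mult_prod:
  assumes "finite X"
  shows "subset_conv (\<lambda>Y. f Y * prod w Y) (\<lambda>Y. g Y * prod w Y) X = subset_conv f g X * prod w X"
  unfolding subset_conv_def sum_distrib_right
proof (rule sum.cong)
  fix B assume "B \<in> Pow X"
  then have "prod w X = prod w B * prod w (X - B)"
    using assms by (simp add: prod.subset_diff mult.commute)
  then show "f B * prod w B * (g (X - B) * prod w (X - B)) = f B * g (X - B) * prod w X"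
    by (simp add: algebra_simps)
qed simp

text \<open>The Leibniz rule: an element \<open>s\<close> of \<open>X\<close> lies in exactly one of
  \<open>B\<close> and \<open>X - B\<close>.\<close>

lemma restrict_mem_subset_conv:
  "restrict_mem s (subset_conv f g) X =
    subset_conv (restrict_mem s f) g X + subset_conv f (restrict_mem s g) X"
  unfolding subset_conv_def restrict_mem_def
  by (auto simp: sum.distrib[symmetric] intro!: sum.cong sum.neutral)

text \<open>The algebraic core. Write \<open>m\<close> for weighting by \<open>prod w\<close>. From
  \<open>b * a = \<delta> a\<close> and \<open>i * a = 1\<close> follows
  \<open>b * i = - \<delta> i\<close>. Since \<open>m\<close> is multiplicative and commutes with
  \<open>\<delta>\<close>, also \<open>m b * m i = - \<delta> (m i)\<close>. Hence \<open>(b - m b)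
  * (m i * a) = m i * \<delta> a + \<delta> (m i) * a\<close>, which the Leibniz rule turns into
  \<open>\<delta> (m i * a)\<close>.\<close>

lemma restrict_mem_subset_conv_inverse:
  fixes a i b :: "'a set \<Rightarrow> 'b::comm_ring_1"
  assumes X: "finite X"
    and inv: "\<And>Y. finite Y \<Longrightarrow> subset_conv i a Y = (if Y = {} then 1 else 0)"
    and b: "\<And>Y. finite Y \<Longrightarrow> subset_conv b a Y = restrict_mem s a Y"
  shows "restrict_mem s (subset_conv (\<lambda>Y. i Y * prod w Y) a) X =
    subset_conv (\<lambda>Y. b Y * (1 - prod w Y)) (subset_conv (\<lambda>Y. i Y * prod w Y) a) X"
proof -
  let ?m = "\<lambda>f Y. f Y * prod w Y" and ?r = "restrict_mem s"
  let ?one = "\<lambda>Y. if Y = {} then 1 else 0 :: 'b"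
  have inv': "subset_conv a i Y = ?one Y" if "finite Y" for Y
    unfolding subset_conv_commute[of a i] by (rule inv[OF that])
  have b_eq: "b Y = - subset_conv (?r i) a Y" if Y: "finite Y" for Y
  proof -
    have "b Y = subset_conv b ?one Y"
      by (rule subset_conv_one_right[OF Y, symmetric])
    also have "\<dots> = subset_conv b (subset_conv a i) Y"
      by (rule subset_conv_cong[OF Y refl inv'[symmetric]])
    also have "\<dots> = subset_conv (subset_conv b a) i Y"
      by (rule subset_conv_assoc[OF Y, symmetric])
    also have "\<dots> = subset_conv (?r a) i Y"
      by (rule subset_conv_cong[OF Y b refl])
    also have "\<dots> = subset_conv i (?r a) Y"
      by (rule subset_conv_commute)
    also have "\<dots> = ?r (subset_conv i a) Y - subset_conv (?r i) a Y"
      by (simp add: restrict_mem_subset_conv)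
    \<comment> \<open>The convolution unit is supported on the empty set, which does not contain
      \<open>s\<close>.\<close>
    also have "?r (subset_conv i a) Y = 0"
      using inv[OF Y] by (auto simp: restrict_mem_def)
    finally show ?thesis by simp
  qed
  have bi: "subset_conv b i Y = - ?r i Y" if Y: "finite Y" for Y
  proof -
    have "subset_conv b i Y = subset_conv (\<lambda>Y. - subset_conv (?r i) a Y) i Y"
      by (rule subset_conv_cong[OF Y b_eq refl])
    also have "\<dots> = - subset_conv (?r i) (subset_conv a i) Y"
      by (simp only: subset_conv_uminus_left subset_conv_assoc[OF Y])
    also have "subset_conv (?r i) (subset_conv a i) Y = subset_conv (?r i) ?one Y"
      by (rule subset_conv_cong[OF Y refl inv'])
    also have "\<dots> = ?r i Y"
      by (rule subset_conv_one_right[OF Y])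
    finally show ?thesis .
  qed
  have "subset_conv (\<lambda>Y. b Y * (1 - prod w Y)) (subset_conv (?m i) a) X =
      subset_conv b (subset_conv (?m i) a) X - subset_conv (?m b) (subset_conv (?m i) a) X"
    by (simp add: right_diff_distrib subset_conv_diff_left)
  also have "subset_conv b (subset_conv (?m i) a) X = subset_conv (?m i) (?r a) X"
  proof -
    have "subset_conv b (subset_conv (?m i) a) X = subset_conv b (subset_conv a (?m i)) X"
      by (rule subset_conv_cong[OF X refl]) (rule subset_conv_commute)
    also have "\<dots> = subset_conv (subset_conv b a) (?m i) X"
      by (rule subset_conv_assoc[OF X, symmetric])
    also have "\<dots> = subset_conv (?r a) (?m i) X"
      by (rule subset_conv_cong[OF X b refl])
    also have "\<dots> = subset_conv (?m i) (?r a) X"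
      by (rule subset_conv_commute)
    finally show ?thesis .
  qed
  also have "subset_conv (?m b) (subset_conv (?m i) a) X = - subset_conv (?r (?m i)) a X"
  proof -
    have "subset_conv (?m b) (subset_conv (?m i) a) X = subset_conv (subset_conv (?m b) (?m i)) a X"
      by (rule subset_conv_assoc[OF X, symmetric])
    also have "\<dots> = subset_conv (\<lambda>Y. - ?r (?m i) Y) a X"
      by (rule subset_conv_cong[OF X _ refl])
        (simp add: subset_conv_mult_prod bi restrict_mem_def)
    finally show ?thesis by (simp add: subset_conv_uminus_left)
  qed
  finally show ?thesis by (simp add: restrict_mem_subset_conv)
qed

lemma prod_one_minus:
  fixes w :: "'a \<Rightarrow> 'b::comm_ring_1"
  assumes "finite S"
  shows "(\<Prod>v\<in>S. 1 - w v) = (\<Sum>T\<in>Pow S. (- 1) ^ card T * prod w T)"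
  using assms
proof (induction S)
  case (insert v S)
  let ?f = "\<lambda>T. (- 1) ^ card T * prod w T"
  have "sum ?f (Pow (insert v S)) = sum ?f (Pow S) + sum ?f (insert v ` Pow S)"
    unfolding Pow_insert using insert by (intro sum.union_disjoint) auto
  also have "sum ?f (insert v ` Pow S) = (\<Sum>T\<in>Pow S. - w v * ?f T)"
  proof (subst sum.reindex)
    show "inj_on (insert v) (Pow S)"
      using insert(2) by (auto simp: inj_on_def)
    show "sum (?f \<circ> insert v) (Pow S) = (\<Sum>T\<in>Pow S. - w v * ?f T)"
    proof (rule sum.cong)
      fix T assume "T \<in> Pow S"
      then have "finite T" "v \<notin> T" using insert(1,2) by (auto dest: finite_subset)
      then show "(?f \<circ> insert v) T = - w v * ?f T" by (simp add: algebra_simps)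
    qed simp
  qed
  also have "\<dots> = - w v * sum ?f (Pow S)"
    by (simp only: sum_distrib_left)
  finally show ?case using insert by (simp add: left_diff_distrib)
qed simp

section \<open>Splitting an acyclic orientation\<close>

definition acyclic_on :: "'a set set \<Rightarrow> 'a set \<Rightarrow> ('a \<times> 'a) set set" where
  "acyclic_on E X = acyclic_orientations {e \<in> E. e \<subseteq> X}"

text \<open>The conjunct \<open>s \<in> B\<close> excludes the empty block, for which the
  reachability condition would hold vacuously. Sums may thus range over all subsets
  \<open>B\<close>.\<close>

definition acyclic_to :: "'a set set \<Rightarrow> 'a \<Rightarrow> 'a set \<Rightarrow> ('a \<times> 'a) set set" where
  "acyclic_to E s B = {D \<in> acyclic_on E B. s \<in> B \<and> (\<forall>v\<in>B. (v, s) \<in> D\<^sup>*)}"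

text \<open>Every edge across the cut points from \<open>B\<close> to \<open>C\<close>, so that no
  path leaves \<open>C\<close>.\<close>

definition join_orientations ::
  "'a set set \<Rightarrow> 'a set \<Rightarrow> 'a set \<Rightarrow> ('a \<times> 'a) set \<Rightarrow> ('a \<times> 'a) set \<Rightarrow> ('a \<times> 'a) set" where
  "join_orientations E B C D1 D2 = D1 \<union> D2 \<union> {(u, v). u \<in> B \<and> v \<in> C \<and> {u, v} \<in> E}"

section \<open>Acyclic orientations of induced subgraphs\<close>

lemma acyclic_on_iff:
  "D \<in> acyclic_on E X \<longleftrightarrow> acyclic D \<and>
    (\<forall>u v. (u, v) \<in> D \<longrightarrow> {u, v} \<in> E \<and> u \<in> X \<and> v \<in> X) \<and>
    (\<forall>u v. {u, v} \<in> E \<longrightarrow> u \<in> X \<longrightarrow> v \<in> X \<longrightarrow> ((u, v) \<in> D \<longleftrightarrow> (v, u) \<notin> D))"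
  unfolding acyclic_on_def acyclic_orientations_def orientation_def by auto

lemma acyclic_on_acyclic: "D \<in> acyclic_on E X \<Longrightarrow> acyclic D"
  by (simp only: acyclic_on_iff)

lemma acyclic_on_edge:
  assumes "D \<in> acyclic_on E X" "(u, v) \<in> D"
  shows "{u, v} \<in> E" "u \<in> X" "v \<in> X"
  using assms unfolding acyclic_on_iff by blast+

lemma acyclic_on_orient:
  assumes "D \<in> acyclic_on E X" "{u, v} \<in> E" "u \<in> X" "v \<in> X"
  shows "(u, v) \<in> D \<longleftrightarrow> (v, u) \<notin> D"
  using assms unfolding acyclic_on_iff by blast

lemma acyclic_on_subset: "D \<in> acyclic_on E X \<Longrightarrow> D \<subseteq> X \<times> X"
  by (auto dest: acyclic_on_edge)

lemma finite_acyclic_on: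
  assumes "finite X"
  shows "finite (acyclic_on E X)"
  by (rule finite_subset[of _ "Pow (X \<times> X)"]) (use assms in \<open>auto dest: acyclic_on_edge\<close>)

lemma acyclic_on_no_edges:
  assumes "\<And>e. e \<in> E \<Longrightarrow> \<not> e \<subseteq> X"
  shows "acyclic_on E X = {{}}"
proof
  show "acyclic_on E X \<subseteq> {{}}"
  proof (rule subsetI)
    fix D assume D: "D \<in> acyclic_on E X"
    have "(u, v) \<notin> D" for u v
      using acyclic_on_edge[OF D, of u v] assms[of "{u, v}"] by blast
    then show "D \<in> {{}}" by auto
  qed
  have "{u, v} \<notin> E" if "u \<in> X" "v \<in> X" for u v
    using assms[of "{u, v}"] that by blast
  moreover have "acyclic {}" by (simp add: acyclic_def)
  ultimately have "{} \<in> acyclic_on E X"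
    by (auto simp: acyclic_on_iff)
  then show "{{}} \<subseteq> acyclic_on E X" by simp
qed

section \<open>Paths and cycles relative to a closed vertex set\<close>

lemma trancl_stays_in:
  assumes "(u, v) \<in> D\<^sup>+" "u \<in> S" "\<And>x y. (x, y) \<in> D \<Longrightarrow> x \<in> S \<Longrightarrow> y \<in> S"
  shows "v \<in> S \<and> (u, v) \<in> (D \<inter> S \<times> S)\<^sup>+"
  using assms(1)
proof (induction rule: trancl_induct)
  case (base y)
  then show ?case using assms(2,3) by blast
next
  case (step y z)
  then have "(y, z) \<in> D \<inter> S \<times> S" using assms(3) by blast
  then show ?case using step.IH by (blast intro: trancl_into_trancl)
qed

lemma rtrancl_stays_in:
  assumes "(u, v) \<in> D\<^sup>*" "u \<in> S" "\<And>x y. (x, y) \<in> D \<Longrightarrow> x \<in> S \<Longrightarrow> y \<in> S"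
  shows "v \<in> S \<and> (u, v) \<in> (D \<inter> S \<times> S)\<^sup>*"
  using trancl_stays_in[of u v D S] assms by (auto simp: rtrancl_eq_or_trancl)

lemma rtrancl_stays_in_backward:
  assumes "(u, v) \<in> D\<^sup>*" "v \<in> S" "\<And>x y. (x, y) \<in> D \<Longrightarrow> y \<in> S \<Longrightarrow> x \<in> S"
  shows "u \<in> S \<and> (u, v) \<in> (D \<inter> S \<times> S)\<^sup>*"
proof -
  have "(v, u) \<in> (D\<inverse>)\<^sup>*" using assms(1) by (simp add: rtrancl_converse)
  then have "u \<in> S \<and> (v, u) \<in> (D\<inverse> \<inter> S \<times> S)\<^sup>*"
    by (rule rtrancl_stays_in) (use assms in auto)
  moreover have "D\<inverse> \<inter> S \<times> S = (D \<inter> S \<times> S)\<inverse>" by auto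
  ultimately show ?thesis by (simp add: rtrancl_converse)
qed

text \<open>A cycle through \<open>S\<close> can never leave it. A cycle starting outside
  \<open>S\<close> never enters it, because the complement is closed under the reversed
  arcs.\<close>

lemma acyclic_split:
  assumes "acyclic (D \<inter> S \<times> S)" "acyclic (D \<inter> (- S) \<times> (- S))"
    and closed: "\<And>x y. (x, y) \<in> D \<Longrightarrow> x \<in> S \<Longrightarrow> y \<in> S"
  shows "acyclic D"
  unfolding acyclic_def
proof (intro allI notI)
  fix x assume x: "(x, x) \<in> D\<^sup>+"
  show False
  proof (cases "x \<in> S")
    case True
    then show False using trancl_stays_in[OF x True] closed assms(1) by (auto simp: acyclic_def)
  next
    case False
    have "(x, x) \<in> (D\<inverse>)\<^sup>+" using x by (simp add: trancl_converse)
    then have "(x, x) \<in> (D\<inverse> \<inter> (- S) \<times> (- S))\<^sup>+"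
      using trancl_stays_in[of x x "D\<inverse>" "- S"] False closed by auto
    moreover have "D\<inverse> \<inter> (- S) \<times> (- S) = (D \<inter> (- S) \<times> (- S))\<inverse>" by auto
    ultimately show False using assms(2) by (auto simp: trancl_converse acyclic_def)
  qed
qed

section \<open>Gluing two orientations along a cut\<close>

lemma join_orientations_inter:
  assumes "D1 \<in> acyclic_on E B" "D2 \<in> acyclic_on E C" "B \<inter> C = {}"
  shows "join_orientations E B C D1 D2 \<inter> B \<times> B = D1"
    and "join_orientations E B C D1 D2 \<inter> C \<times> C = D2"
  using acyclic_on_subset[OF assms(1)] acyclic_on_subset[OF assms(2)] assms(3)
  unfolding join_orientations_def by auto

lemma join_orientations_closed:
  assumes "D1 \<in> acyclic_on E B" "D2 \<in> acyclic_on E C" "B \<inter> C = {}"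
    and "(x, y) \<in> join_orientations E B C D1 D2" "x \<in> C"
  shows "y \<in> C"
  using acyclic_on_subset[OF assms(1)] acyclic_on_subset[OF assms(2)] assms(3-5)
  unfolding join_orientations_def by auto

lemma join_orientations_acyclic_on:
  assumes D: "D1 \<in> acyclic_on E B" "D2 \<in> acyclic_on E C" "B \<inter> C = {}"
  shows "join_orientations E B C D1 D2 \<in> acyclic_on E (B \<union> C)"
proof -
  let ?D = "join_orientations E B C D1 D2"
  have sub: "?D \<subseteq> (B \<union> C) \<times> (B \<union> C)"
    using acyclic_on_subset[OF D(1)] acyclic_on_subset[OF D(2)]
    unfolding join_orientations_def by auto
  \<comment> \<open>The join lives on \<open>B \<union> C\<close>, so outside \<open>C\<close> only
    the arcs of \<open>D1\<close> remain and \<open>acyclic_split\<close> applies with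
    \<open>S = C\<close>.\<close>
  have "?D \<inter> (- C) \<times> (- C) = ?D \<inter> B \<times> B" using sub D(3) by blast
  then have "acyclic (?D \<inter> C \<times> C)" "acyclic (?D \<inter> (- C) \<times> (- C))"
    using D(1,2) by (simp_all add: join_orientations_inter[OF D] acyclic_on_acyclic)
  then have acyc: "acyclic ?D"
    by (rule acyclic_split) (rule join_orientations_closed[OF D])
  have edge: "{u, v} \<in> E" if "(u, v) \<in> ?D" for u v
    using that acyclic_on_edge(1)[OF D(1)] acyclic_on_edge(1)[OF D(2)]
    unfolding join_orientations_def by blast
  have orient: "(u, v) \<in> ?D \<longleftrightarrow> (v, u) \<notin> ?D" if uv: "{u, v} \<in> E" "u \<in> B \<union> C" "v \<in> B \<union> C" for u v
  proof -
    have vu: "{v, u} \<in> E" using uv(1) by (simp add: insert_commute)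
    have in_B: "(x, y) \<in> ?D \<longleftrightarrow> (x, y) \<in> D1" if "x \<in> B" "y \<in> B" for x y
      using join_orientations_inter(1)[OF D] that by blast
    have in_C: "(x, y) \<in> ?D \<longleftrightarrow> (x, y) \<in> D2" if "x \<in> C" "y \<in> C" for x y
      using join_orientations_inter(2)[OF D] that by blast
    have across: "(x, y) \<in> ?D" "(y, x) \<notin> ?D" if "x \<in> B" "y \<in> C" "{x, y} \<in> E" for x y
      using that D(3) join_orientations_closed[OF D, of y x] by (auto simp: join_orientations_def)
    consider "u \<in> B" "v \<in> B" | "u \<in> C" "v \<in> C" | "u \<in> B" "v \<in> C" | "u \<in> C" "v \<in> B"
      using uv(2,3) by blast
    then show ?thesis
    proof cases
      case 1
      then show ?thesis using in_B acyclic_on_orient[OF D(1) uv(1)] by blast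
    next
      case 2
      then show ?thesis using in_C acyclic_on_orient[OF D(2) uv(1)] by blast
    next
      case 3
      then show ?thesis using across[of u v] uv(1) by simp
    next
      case 4
      then show ?thesis using across[of v u] vu by simp
    qed
  qed
  have "u \<in> B \<union> C" "v \<in> B \<union> C" if "(u, v) \<in> ?D" for u v
    using sub that by blast+
  with acyc edge orient show ?thesis unfolding acyclic_on_iff by (intro conjI allI impI)
qed

lemma restrict_acyclic_on:
  assumes "D \<in> acyclic_on E X" "B \<subseteq> X"
  shows "D \<inter> B \<times> B \<in> acyclic_on E B"
proof -
  have "acyclic (D \<inter> B \<times> B)"
    using acyclic_on_acyclic[OF assms(1)] by (rule acyclic_subset) blast
  moreover have "(u, v) \<in> D \<longleftrightarrow> (v, u) \<notin> D" if "{u, v} \<in> E" "u \<in> B" "v \<in> B" for u v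
    using that assms(2) by (intro acyclic_on_orient[OF assms(1)]) auto
  ultimately show ?thesis
    unfolding acyclic_on_iff using acyclic_on_edge(1)[OF assms(1)] by blast
qed

text \<open>Since no arc leaves \<open>C\<close>, each edge across the cut has its direction forced,
  and the two restrictions determine \<open>D\<close>.\<close>

lemma join_orientations_restrict:
  assumes "D \<in> acyclic_on E (B \<union> C)" "B \<inter> C = {}" "\<And>x y. (x, y) \<in> D \<Longrightarrow> x \<in> C \<Longrightarrow> y \<in> C"
  shows "join_orientations E B C (D \<inter> B \<times> B) (D \<inter> C \<times> C) = D"
proof -
  have "(u, v) \<in> D" if uv: "u \<in> B" "v \<in> C" "{u, v} \<in> E" for u v
  proof -
    have "(v, u) \<notin> D" using assms(2,3) uv by blast
    then show ?thesis using acyclic_on_orient[OF assms(1) uv(3)] uv by blast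
  qed
  then show ?thesis
    using acyclic_on_edge(1)[OF assms(1)] acyclic_on_subset[OF assms(1)] assms(3) unfolding join_orientations_def by blast
qed

text \<open>Used with \<open>C\<close> an independent set: having no arc leave it then means that
  all its vertices are sinks.\<close>

lemma bij_betw_join_orientations:
  assumes "B \<inter> C = {}"
  shows "bij_betw (\<lambda>(D1, D2). join_orientations E B C D1 D2) (acyclic_on E B \<times> acyclic_on E C)
    {D \<in> acyclic_on E (B \<union> C). \<forall>x y. (x, y) \<in> D \<longrightarrow> x \<in> C \<longrightarrow> y \<in> C}"
  by (rule bij_betw_byWitness[where f'="\<lambda>D. (D \<inter> B \<times> B, D \<inter> C \<times> C)"])
    (use assms in \<open>auto simp: join_orientations_inter join_orientations_restrict
        join_orientations_acyclic_on intro: restrict_acyclic_on dest: join_orientations_closed\<close>)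

text \<open>Vertices of \<open>B\<close> reach \<open>s\<close> already inside \<open>D1\<close>,
  while a path starting in \<open>C\<close> stays in \<open>C\<close>, which misses
  \<open>s\<close>.\<close>

lemma join_orientations_reach:
  assumes D: "D1 \<in> acyclic_to E s B" "D2 \<in> acyclic_on E C" "B \<inter> C = {}"
  shows "{v \<in> B \<union> C. (v, s) \<in> (join_orientations E B C D1 D2)\<^sup>*} = B"
proof -
  let ?D = "join_orientations E B C D1 D2"
  have D1: "D1 \<in> acyclic_on E B" and s: "s \<in> B" and to: "\<forall>v\<in>B. (v, s) \<in> D1\<^sup>*"
    using D(1) by (auto simp: acyclic_to_def)
  have "(v, s) \<in> ?D\<^sup>*" if "v \<in> B" for v
    using that to rtrancl_mono[of D1 ?D] by (auto simp: join_orientations_def)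
  moreover have "(v, s) \<notin> ?D\<^sup>*" if "v \<in> C" for v
    using rtrancl_stays_in[of v s ?D C] that s D(3) join_orientations_closed[OF D1 D(2,3)] by blast
  ultimately show ?thesis by blast
qed

text \<open>The set of vertices reaching \<open>s\<close> is closed under predecessors. Hence no arc
  leads from \<open>C\<close> back to \<open>B\<close>, and every path to \<open>s\<close> from a
  vertex of \<open>B\<close> stays in \<open>B\<close>, so that reachability survives
  restriction.\<close>

lemma bij_betw_join_orientations_reach:
  assumes disj: "B \<inter> C = {}" and s: "s \<in> B"
  shows "bij_betw (\<lambda>(D1, D2). join_orientations E B C D1 D2) (acyclic_to E s B \<times> acyclic_on E C)
    {D \<in> acyclic_on E (B \<union> C). {v \<in> B \<union> C. (v, s) \<in> D\<^sup>*} = B}"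
proof (rule bij_betw_byWitness[where f'="\<lambda>D. (D \<inter> B \<times> B, D \<inter> C \<times> C)"])
  let ?A = "{D \<in> acyclic_on E (B \<union> C). {v \<in> B \<union> C. (v, s) \<in> D\<^sup>*} = B}"
  have to_on: "D \<in> acyclic_on E B" if "D \<in> acyclic_to E s B" for D
    using that by (simp add: acyclic_to_def)
  have on: "D \<in> acyclic_on E (B \<union> C)" if "D \<in> ?A" for D
    using that unfolding mem_Collect_eq by (rule conjunct1)
  have reach: "v \<in> B \<longleftrightarrow> v \<in> B \<union> C \<and> (v, s) \<in> D\<^sup>*" if "D \<in> ?A" for D v
  proof -
    have "{v \<in> B \<union> C. (v, s) \<in> D\<^sup>*} = B" using that unfolding mem_Collect_eq by (rule conjunct2)
    from this[THEN eqset_imp_iff, of v] show ?thesis by simp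
  qed
  have backward: "x \<in> B" if D: "D \<in> ?A" and xy: "(x, y) \<in> D" and "y \<in> B" for D x y
  proof -
    have "x \<in> B \<union> C" using acyclic_on_edge(2)[OF on[OF D] xy] .
    moreover have "(y, s) \<in> D\<^sup>*" using reach[OF D] \<open>y \<in> B\<close> by blast
    ultimately show ?thesis
      using reach[OF D] converse_rtrancl_into_rtrancl[OF xy] by blast
  qed
  have forward: "y \<in> C" if "D \<in> ?A" "(x, y) \<in> D" "x \<in> C" for D x y
  proof -
    have "y \<in> B \<union> C" using acyclic_on_edge(3)[OF on[OF that(1)] that(2)] .
    then show ?thesis using backward[OF that(1,2)] that(3) disj by auto
  qed
  show "\<forall>p\<in>acyclic_to E s B \<times> acyclic_on E C.
      (\<lambda>D. (D \<inter> B \<times> B, D \<inter> C \<times> C)) ((\<lambda>(D1, D2). join_orientations E B C D1 D2) p) = p"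
    using join_orientations_inter[OF to_on _ disj] by (simp add: split_paired_all)
  show "\<forall>D\<in>?A. (\<lambda>(D1, D2). join_orientations E B C D1 D2) (D \<inter> B \<times> B, D \<inter> C \<times> C) = D"
  proof
    fix D assume D: "D \<in> ?A"
    from join_orientations_restrict[OF on[OF D] disj forward[OF D]]
    show "(\<lambda>(D1, D2). join_orientations E B C D1 D2) (D \<inter> B \<times> B, D \<inter> C \<times> C) = D"
      by simp
  qed
  show "(\<lambda>(D1, D2). join_orientations E B C D1 D2) ` (acyclic_to E s B \<times> acyclic_on E C) \<subseteq> ?A"
  proof (rule image_subsetI)
    fix p assume "p \<in> acyclic_to E s B \<times> acyclic_on E C"
    then obtain D1 D2 where p: "p = (D1, D2)" "D1 \<in> acyclic_to E s B" "D2 \<in> acyclic_on E C"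
      by blast
    have "join_orientations E B C D1 D2 \<in> ?A"
      by (intro CollectI conjI join_orientations_acyclic_on[OF to_on[OF p(2)] p(3) disj]
          join_orientations_reach[OF p(2,3) disj])
    then show "(\<lambda>(D1, D2). join_orientations E B C D1 D2) p \<in> ?A" by (simp add: p(1))
  qed
  show "(\<lambda>D. (D \<inter> B \<times> B, D \<inter> C \<times> C)) ` ?A \<subseteq> acyclic_to E s B \<times> acyclic_on E C"
  proof (rule image_subsetI)
    fix D assume D: "D \<in> ?A"
    have "(v, s) \<in> (D \<inter> B \<times> B)\<^sup>*" if "v \<in> B" for v
    proof -
      have "(v, s) \<in> D\<^sup>*" using reach[OF D] that by blast
      from rtrancl_stays_in_backward[OF this s backward[OF D]] show ?thesis by (rule conjunct2)
    qed
    with on[OF D] show "(D \<inter> B \<times> B, D \<inter> C \<times> C) \<in> acyclic_to E s B \<times> acyclic_on E C"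
      using s by (simp add: acyclic_to_def restrict_acyclic_on)
  qed
qed

text \<open>The orientations are grouped by the set \<open>B\<close> of vertices that reach
  \<open>s\<close>.\<close>

lemma sum_acyclic_on_reach:
  fixes f :: "('a \<times> 'a) set \<Rightarrow> 'b::comm_monoid_add"
  assumes X: "finite X" and s: "s \<in> X"
  shows "(\<Sum>D\<in>acyclic_on E X. f D) =
    (\<Sum>B\<in>Pow X. \<Sum>D1\<in>acyclic_to E s B. \<Sum>D2\<in>acyclic_on E (X - B).
      f (join_orientations E B (X - B) D1 D2))"
proof -
  let ?R = "\<lambda>D. {v \<in> X. (v, s) \<in> D\<^sup>*}"
  have "sum f (acyclic_on E X) = (\<Sum>B\<in>Pow X. \<Sum>D\<in>{D \<in> acyclic_on E X. ?R D = B}. f D)"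
    using X by (intro sum.group[symmetric]) (auto simp: finite_acyclic_on)
  also have "\<dots> = (\<Sum>B\<in>Pow X. \<Sum>D1\<in>acyclic_to E s B. \<Sum>D2\<in>acyclic_on E (X - B).
      f (join_orientations E B (X - B) D1 D2))"
  proof (rule sum.cong)
    fix B assume B: "B \<in> Pow X"
    show "(\<Sum>D\<in>{D \<in> acyclic_on E X. ?R D = B}. f D) = (\<Sum>D1\<in>acyclic_to E s B.
        \<Sum>D2\<in>acyclic_on E (X - B). f (join_orientations E B (X - B) D1 D2))"
    proof (cases "s \<in> B")
      case True
      have "B \<union> (X - B) = X" using B by auto
      then have "(\<Sum>D\<in>{D \<in> acyclic_on E X. ?R D = B}. f D) =
          (\<Sum>(D1, D2)\<in>acyclic_to E s B \<times> acyclic_on E (X - B). f (join_orientations E B (X - B) D1 D2))"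
        using sum.reindex_bij_betw[OF bij_betw_join_orientations_reach[of B "X - B" s E], of f] True
        by (simp add: case_prod_unfold)
      then show ?thesis by (simp add: sum.cartesian_product)
    next
      case False
      \<comment> \<open>As \<open>s\<close> reaches itself, a set \<open>B\<close> without
        \<open>s\<close> never occurs.\<close>
      then have "{D \<in> acyclic_on E X. ?R D = B} = {}" "acyclic_to E s B = {}"
        using s by (auto simp: acyclic_to_def)
      then show ?thesis by (metis (no_types, lifting) sum.empty)
    qed
  qed simp
  finally show ?thesis .
qed

section \<open>Expansion over sinks\<close>

abbreviation sinks_on :: "'a set set \<Rightarrow> 'a set \<Rightarrow> ('a \<times> 'a) set \<Rightarrow> 'a set" where
  "sinks_on E X D \<equiv> sinks X {e \<in> E. e \<subseteq> X} D"

text \<open>The signed generating function of independent sets, as in Cartier-Foata inversion. The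
  empty set has sign 1.\<close>

definition independent_sign :: "'a set set \<Rightarrow> 'a set \<Rightarrow> 'b::comm_ring_1" where
  "independent_sign E S = (if \<exists>e\<in>E. e \<subseteq> S then 0 else (- 1) ^ card S)"

lemma sinks_on_iff:
  assumes "D \<in> acyclic_on E X"
  shows "v \<in> sinks_on E X D \<longleftrightarrow> v \<in> X \<and> (\<forall>u. (v, u) \<notin> D)"
proof
  assume v: "v \<in> sinks_on E X D"
  have "(v, u) \<notin> D" for u
  proof
    assume vu: "(v, u) \<in> D"
    note uv = acyclic_on_edge[OF assms this]
    then have e: "{u, v} \<in> E" by (simp add: insert_commute)
    then have "(u, v) \<in> D" using v uv by (auto simp: sinks_def)
    then show False using vu acyclic_on_orient[OF assms e] uv by blast
  qed
  then show "v \<in> X \<and> (\<forall>u. (v, u) \<notin> D)" using v by (auto simp: sinks_def)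
next
  assume v: "v \<in> X \<and> (\<forall>u. (v, u) \<notin> D)"
  have "(u, v) \<in> D" if "{u, v} \<in> E" "{u, v} \<subseteq> X" for u
    using acyclic_on_orient[OF assms that(1)] that(2) v by blast
  then show "v \<in> sinks_on E X D" using v by (auto simp: sinks_def)
qed

text \<open>The reversed arcs of a finite acyclic relation are well-founded, and a minimal vertex
  has no outgoing arc.\<close>

lemma sinks_on_nonempty:
  assumes X: "finite X" "X \<noteq> {}" and D: "D \<in> acyclic_on E X"
  shows "sinks_on E X D \<noteq> {}"
proof -
  have "D \<subseteq> X \<times> X" "acyclic D"
    using D by (rule acyclic_on_subset, rule acyclic_on_acyclic)
  then have "finite D" using X(1) by (auto intro: finite_subset)
  then have "wf (D\<inverse>)" using \<open>acyclic D\<close> by (rule finite_acyclic_wf_converse)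
  then obtain z where "z \<in> X" "\<And>y. (y, z) \<in> D\<inverse> \<Longrightarrow> y \<notin> X"
    using X(2) by (metis wfE_min equals0I)
  then show ?thesis using sinks_on_iff[OF D] \<open>D \<subseteq> X \<times> X\<close> by blast
qed

text \<open>Adjacent vertices cannot both be sinks. If \<open>S\<close> is independent, its vertices
  are all sinks exactly when no arc leaves \<open>S\<close>. Such orientations are joins over the
  cut at \<open>S\<close>, and \<open>S\<close> itself carries only the empty orientation.\<close>

lemma card_acyclic_on_sinks:
  assumes E: "\<And>e. e \<in> E \<Longrightarrow> card e = 2" and S: "S \<subseteq> X"
  shows "card {D \<in> acyclic_on E X. S \<subseteq> sinks_on E X D} =
    (if \<exists>e\<in>E. e \<subseteq> S then 0 else card (acyclic_on E (X - S)))"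
proof (cases "\<exists>e\<in>E. e \<subseteq> S")
  case True
  then obtain e where e: "e \<in> E" "e \<subseteq> S" by blast
  then obtain u v where uv: "e = {u, v}" using E by (meson card_2_iff)
  have "\<not> S \<subseteq> sinks_on E X D" if D: "D \<in> acyclic_on E X" for D
  proof -
    have "(u, v) \<in> D \<or> (v, u) \<in> D" 
      using acyclic_on_orient[OF D, of u v] e uv S by blast
    then show ?thesis using sinks_on_iff[OF D] e uv by blast
  qed
  then have "{D \<in> acyclic_on E X. S \<subseteq> sinks_on E X D} = {}" by blast
  then show ?thesis using True by (metis card.empty)
next
  case False
  have "(X - S) \<union> S = X" using S by auto
  have eq: "{D \<in> acyclic_on E X. S \<subseteq> sinks_on E X D} =
      {D \<in> acyclic_on E X. \<forall>x y. (x, y) \<in> D \<longrightarrow> x \<in> S \<longrightarrow> y \<in> S}"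
  proof (rule Collect_cong, rule conj_cong[OF refl])
    fix D assume D: "D \<in> acyclic_on E X"
    show "S \<subseteq> sinks_on E X D \<longleftrightarrow> (\<forall>x y. (x, y) \<in> D \<longrightarrow> x \<in> S \<longrightarrow> y \<in> S)"
    proof (intro iffI allI impI subsetI)
      fix x y assume "S \<subseteq> sinks_on E X D" "(x, y) \<in> D" "x \<in> S"
      then show "y \<in> S" using sinks_on_iff[OF D, of x] by blast
    next
      fix x assume closed: "\<forall>x y. (x, y) \<in> D \<longrightarrow> x \<in> S \<longrightarrow> y \<in> S" and x: "x \<in> S"
      have "(x, u) \<notin> D" for u
      proof
        assume xu: "(x, u) \<in> D"
        then have "{x, u} \<subseteq> S" using closed x by blast
        then show False using acyclic_on_edge(1)[OF D xu] False by blast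
      qed
      then show "x \<in> sinks_on E X D" using sinks_on_iff[OF D] x S by blast
    qed
  qed
  have "card (acyclic_on E (X - S) \<times> acyclic_on E S) =
      card {D \<in> acyclic_on E X. S \<subseteq> sinks_on E X D}"
    using bij_betw_same_card[OF bij_betw_join_orientations[of "X - S" S E]]
    unfolding \<open>(X - S) \<union> S = X\<close> eq by blast
  moreover have "acyclic_on E S = {{}}" by (rule acyclic_on_no_edges) (use False in blast)
  ultimately show ?thesis using False by (simp add: card_cartesian_product)
qed

lemma sum_prod_sinks_on:
  fixes w :: "'a \<Rightarrow> 'b::comm_ring_1"
  assumes E: "\<And>e. e \<in> E \<Longrightarrow> card e = 2" and X: "finite X"
  shows "(\<Sum>D\<in>acyclic_on E X. \<Prod>v\<in>sinks_on E X D. 1 - w v) =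
    subset_conv (\<lambda>S. independent_sign E S * prod w S) (\<lambda>Y. of_nat (card (acyclic_on E Y))) X"
proof -
  let ?f = "\<lambda>S. (- 1) ^ card S * prod w S" and ?S = "\<lambda>D. sinks_on E X D"
  have sub: "?S D \<subseteq> X" for D by (auto simp: sinks_def)
  have "(\<Sum>D\<in>acyclic_on E X. \<Prod>v\<in>?S D. 1 - w v) =
      (\<Sum>D\<in>acyclic_on E X. \<Sum>S\<in>Pow X. if S \<subseteq> ?S D then ?f S else 0)"
  proof (rule sum.cong)
    fix D
    have "(\<Prod>v\<in>?S D. 1 - w v) = sum ?f (Pow (?S D))"
      by (rule prod_one_minus) (rule finite_subset[OF sub X])
    also have "\<dots> = sum ?f {S \<in> Pow X. S \<subseteq> ?S D}"
      by (rule sum.cong) (use sub in auto)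
    also have "\<dots> = (\<Sum>S\<in>Pow X. if S \<subseteq> ?S D then ?f S else 0)"
      using X by (intro sum.inter_filter) simp
    finally show "(\<Prod>v\<in>?S D. 1 - w v) = (\<Sum>S\<in>Pow X. if S \<subseteq> ?S D then ?f S else 0)" .
  qed simp
  \<comment> \<open>After the exchange, each \<open>S\<close> is weighted by the number of
    orientations in which it consists of sinks.\<close>
  also have "\<dots> = (\<Sum>S\<in>Pow X. \<Sum>D\<in>acyclic_on E X. if S \<subseteq> ?S D then ?f S else 0)"
    by (rule sum.swap)
  also have "\<dots> = (\<Sum>S\<in>Pow X. of_nat (card {D \<in> acyclic_on E X. S \<subseteq> ?S D}) * ?f S)"
    by (rule sum.cong[OF refl], subst sum.inter_filter[symmetric])
      (use X in \<open>auto simp: finite_acyclic_on\<close>)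
  also have "\<dots> = (\<Sum>S\<in>Pow X. independent_sign E S * prod w S * of_nat (card (acyclic_on E (X - S))))"
    by (rule sum.cong[OF refl]) (auto simp: card_acyclic_on_sinks[OF E] independent_sign_def)
  finally show ?thesis by (simp add: subset_conv_def)
qed

text \<open>With all weights 1 each sink contributes a factor 0, so only orientations without sinks
  survive. These exist only on the empty vertex set.\<close>

lemma independent_sign_inverse:
  assumes E: "\<And>e. e \<in> E \<Longrightarrow> card e = 2" and X: "finite X"
  shows "subset_conv (independent_sign E) (\<lambda>Y. of_nat (card (acyclic_on E Y))) X =
    (if X = {} then 1 else 0 :: 'b::comm_ring_1)"
proof -
  have "subset_conv (independent_sign E) (\<lambda>Y. of_nat (card (acyclic_on E Y))) X =
      (\<Sum>D\<in>acyclic_on E X. \<Prod>v\<in>sinks_on E X D. 0 :: 'b)"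
    using sum_prod_sinks_on[OF E X, where w="\<lambda>_. 1 :: 'b"] by simp
  also have "\<dots> = (if X = {} then 1 else 0)"
  proof (cases "X = {}")
    case True
    have "acyclic_on E {} = {{}}" using E by (intro acyclic_on_no_edges) fastforce
    then show ?thesis using True by (simp add: sinks_def)
  next
    case False
    have "(\<Prod>v\<in>sinks_on E X D. 0 :: 'b) = 0" if "D \<in> acyclic_on E X" for D
    proof -
      have "finite (sinks_on E X D)" using X by (simp add: sinks_def)
      then show ?thesis using sinks_on_nonempty[OF X False that] by (simp add: power_0_left)
    qed
    then show ?thesis using False by simp
  qed
  finally show ?thesis .
qed

section \<open>The first block of the sink-component map\<close>

text \<open>The defining recursion removes the latest block. Removing the first block instead is
  what induction over the vertex set requires.\<close>

lemma uncovered_Suc: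
  "uncovered X r D (Suc j) = uncovered (X - sink_component r D X) r D j"
  by (induction j) auto

lemma sink_components_step:
  assumes "X \<noteq> {}"
  shows "sink_components X r D =
    insert (sink_component r D X) (sink_components (X - sink_component r D X) r D)"
proof -
  let ?c = "\<lambda>Y j. sink_component r D (uncovered Y r D j)"
  let ?X = "X - sink_component r D X"
  have "sink_components X r D =
      insert (?c X 0) {?c X (Suc j) | j. uncovered X r D (Suc j) \<noteq> {}}" (is "_ = ?R")
  proof
    show "sink_components X r D \<subseteq> ?R"
    proof
      fix B assume "B \<in> sink_components X r D"
      then obtain j where j: "B = ?c X j" "uncovered X r D j \<noteq> {}"
        unfolding sink_components_def by blast
      show "B \<in> ?R"
      proof (cases j)
        case 0
        then show ?thesis using j by simp
      next
        case (Suc i)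
        then show ?thesis using j by blast
      qed
    qed
    have "uncovered X r D 0 \<noteq> {}" using assms by simp
    then show "?R \<subseteq> sink_components X r D" unfolding sink_components_def by blast
  qed
  then show ?thesis unfolding uncovered_Suc by (simp add: sink_components_def)
qed

lemma sink_components_cong:
  assumes "\<And>R. R \<subseteq> X \<Longrightarrow> R \<noteq> {} \<Longrightarrow> sink_component r D R = sink_component r D' R"
  shows "sink_components X r D = sink_components X r D'"
proof -
  have sub: "uncovered X r D j \<subseteq> X" for j by (induction j) auto
  have eq: "uncovered X r D j = uncovered X r D' j" for j
  proof (induction j)
    case (Suc j)
    \<comment> \<open>Nothing is known about \<open>least_vertex\<close> of the empty set, but both
      components are empty there.\<close>
    have "sink_component r D (uncovered X r D j) = sink_component r D' (uncovered X r D j)"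
      using assms[OF sub] by (cases "uncovered X r D j = {}") (auto simp: sink_component_def)
    then show ?case using Suc by simp
  qed simp
  show ?thesis unfolding sink_components_def using assms[OF sub] eq by metis
qed

lemma sink_components_subset:
  assumes "B \<in> sink_components X r D"
  shows "B \<subseteq> X"
proof -
  have "uncovered X r D j \<subseteq> X" for j by (induction j) auto
  moreover obtain j where "B = sink_component r D (uncovered X r D j)"
    using assms unfolding sink_components_def by blast
  ultimately show ?thesis by (auto simp: sink_component_def)
qed

text \<open>\<open>B\<close> is exactly the set reaching the least vertex, so it is the first block.
  Paths from \<open>X - B\<close> never enter \<open>B\<close>, so the later blocks depend on
  \<open>D2\<close> alone.\<close>

lemma sink_components_join_orientations:
  assumes V: "finite V" "linear_order_on V r" "X \<subseteq> V" "X \<noteq> {}" and B: "B \<subseteq> X"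
    and D: "D1 \<in> acyclic_to E (least_vertex r X) B" "D2 \<in> acyclic_on E (X - B)"
  shows "sink_components X r (join_orientations E B (X - B) D1 D2) =
    insert B (sink_components (X - B) r D2)"
proof -
  let ?D = "join_orientations E B (X - B) D1 D2"
  have disj: "B \<inter> (X - B) = {}" and un: "B \<union> (X - B) = X" using B by auto
  have D1: "D1 \<in> acyclic_on E B" using D(1) by (simp add: acyclic_to_def)
  have "sink_component r ?D X = B"
    using join_orientations_reach[OF D disj] unfolding un by (simp add: sink_component_def)
  moreover have "sink_component r ?D R = sink_component r D2 R" if R: "R \<subseteq> X - B" for R
  proof -
    have "(v, t) \<in> ?D\<^sup>* \<longleftrightarrow> (v, t) \<in> D2\<^sup>*" if v: "v \<in> X - B" for v t
    proof
      assume "(v, t) \<in> ?D\<^sup>*"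
      then show "(v, t) \<in> D2\<^sup>*"
        using rtrancl_stays_in[OF _ v, of t ?D] join_orientations_closed[OF D1 D(2) disj]
          join_orientations_inter(2)[OF D1 D(2) disj] by auto
    next
      assume "(v, t) \<in> D2\<^sup>*"
      then show "(v, t) \<in> ?D\<^sup>*"
        using rtrancl_mono[of D2 ?D] by (auto simp: join_orientations_def)
    qed
    then show ?thesis using R by (auto simp: sink_component_def)
  qed
  ultimately show ?thesis
    using sink_components_step[OF V(4), of r ?D] sink_components_cong[of "X - B" r ?D D2] by simp
qed

lemma sum_prod_sink_components_step:
  fixes g :: "'a set \<Rightarrow> 'b::comm_ring_1" and E :: "'a set set"
  assumes V: "finite V" "linear_order_on V r" "X \<subseteq> V" "X \<noteq> {}"
  defines "F \<equiv> \<lambda>Y. \<Sum>D\<in>acyclic_on E Y. \<Prod>B\<in>sink_components Y r D. g B"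
  shows "F X = subset_conv (\<lambda>B. of_nat (card (acyclic_to E (least_vertex r X) B)) * g B) F X"
proof -
  let ?s = "least_vertex r X"
  have X: "finite X" using V(1,3) finite_subset by blast
  have s: "?s \<in> X" using least_vertex(1)[OF V] .
  have step: "(\<Prod>C\<in>sink_components X r (join_orientations E B (X - B) D1 D2). g C) =
      g B * (\<Prod>C\<in>sink_components (X - B) r D2. g C)"
    if B: "B \<subseteq> X" and D: "D1 \<in> acyclic_to E ?s B" "D2 \<in> acyclic_on E (X - B)" for B D1 D2
  proof -
    have "sink_components (X - B) r D2 \<subseteq> Pow X"
      using sink_components_subset[of _ "X - B"] by blast
    then have "finite (sink_components (X - B) r D2)"
      using X by (auto intro: finite_subset)
    moreover have "B \<notin> sink_components (X - B) r D2"
      using sink_components_subset[of B "X - B"] D(1) by (auto simp: acyclic_to_def)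
    ultimately show ?thesis
      unfolding sink_components_join_orientations[OF V B D] by simp
  qed
  have "F X = (\<Sum>B\<in>Pow X. \<Sum>D1\<in>acyclic_to E ?s B. \<Sum>D2\<in>acyclic_on E (X - B).
      g B * (\<Prod>C\<in>sink_components (X - B) r D2. g C))"
    unfolding F_def sum_acyclic_on_reach[OF X s] using step by (intro sum.cong refl) auto
  also have "\<dots> = (\<Sum>B\<in>Pow X. of_nat (card (acyclic_to E ?s B)) * g B * F (X - B))"
    by (simp add: F_def sum_distrib_left[symmetric] mult.assoc)
  finally show ?thesis by (simp add: subset_conv_def)
qed

lemma subset_conv_card_acyclic_to:
  assumes "finite X"
  shows "subset_conv (\<lambda>B. of_nat (card (acyclic_to E s B))) (\<lambda>Y. of_nat (card (acyclic_on E Y))) X =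
    restrict_mem s (\<lambda>Y. of_nat (card (acyclic_on E Y)) :: 'b::comm_ring_1) X"
proof (cases "s \<in> X")
  case True
  then show ?thesis
    using sum_acyclic_on_reach[OF assms True, of "\<lambda>_. 1 :: 'b" E]
    by (simp add: restrict_mem_def subset_conv_def)
next
  case False
  then have "acyclic_to E s B = {}" if "B \<subseteq> X" for B
    using that by (auto simp: acyclic_to_def)
  then show ?thesis using False by (simp add: restrict_mem_def subset_conv_def)
qed

lemma sum_prod_sinks_on_eq:
  fixes x :: "'a \<Rightarrow> 'b::comm_ring_1"
  assumes E: "\<And>e. e \<in> E \<Longrightarrow> card e = 2" and V: "finite V" "linear_order_on V r" and "X \<subseteq> V"
  shows "(\<Sum>D\<in>acyclic_on E X. \<Prod>v\<in>sinks_on E X D. x v) =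
    (\<Sum>D\<in>acyclic_on E X. \<Prod>B\<in>sink_components X r D. 1 - (\<Prod>v\<in>B. 1 - x v))"
proof -
  let ?w = "\<lambda>v. 1 - x v"
  let ?a = "\<lambda>Y. of_nat (card (acyclic_on E Y)) :: 'b"
  let ?A = "subset_conv (\<lambda>S. independent_sign E S * prod ?w S) ?a"
  let ?F = "\<lambda>Y. \<Sum>D\<in>acyclic_on E Y. \<Prod>B\<in>sink_components Y r D. 1 - prod ?w B"
  have "finite X" using \<open>X \<subseteq> V\<close> V(1) by (rule finite_subset)
  then have "?A X = ?F X" using \<open>X \<subseteq> V\<close>
  proof (induction X rule: finite_psubset_induct)
    case (psubset X)
    show ?case
    proof (cases "X = {}")
      case True
      have "acyclic_on E {} = {{}}" using E by (intro acyclic_on_no_edges) fastforce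
      moreover have "uncovered {} r D j = {}" for D j by (induction j) auto
      moreover have "{} \<notin> E" using E by fastforce
      ultimately show ?thesis
        using True by (simp add: subset_conv_def sink_components_def independent_sign_def)
    next
      case False
      let ?s = "least_vertex r X"
      let ?b = "\<lambda>B. of_nat (card (acyclic_to E ?s B)) * (1 - prod ?w B) :: 'b"
      have "?s \<in> X" using least_vertex(1)[OF V psubset.prems False] .
      then have "?A X = restrict_mem ?s ?A X" by (simp add: restrict_mem_def)
      also have "\<dots> = subset_conv ?b ?A X"
        by (intro restrict_mem_subset_conv_inverse psubset.hyps
            independent_sign_inverse[OF E] subset_conv_card_acyclic_to)
      also have "\<dots> = subset_conv ?b ?F X"
        unfolding subset_conv_def[of ?b]
      proof (rule sum.cong[OF refl])
        fix B assume B: "B \<in> Pow X"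
        show "?b B * ?A (X - B) = ?b B * ?F (X - B)"
        proof (cases "?s \<in> B")
          case True
          then have "X - B \<subset> X" using B by auto
          then show ?thesis using psubset.IH[of "X - B"] psubset.prems by simp
        next
          case False
          then have "acyclic_to E ?s B = {}" by (auto simp: acyclic_to_def)
          then show ?thesis by simp
        qed
      qed
      also have "\<dots> = ?F X"
        using sum_prod_sink_components_step[OF V psubset.prems False, of "\<lambda>B. 1 - prod ?w B" E]
        by simp
      finally show ?thesis .
    qed
  qed
  moreover have "?A X = (\<Sum>D\<in>acyclic_on E X. \<Prod>v\<in>sinks_on E X D. x v)"
    using sum_prod_sinks_on[OF E \<open>finite X\<close>, where w="?w"] by simp
  ultimately show ?thesis by simp
qed

theorem theorem3p14:
  fixes V :: "'a set" and E :: "'a set set" and r :: "('a \<times> 'a) set"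
  assumes "simple_graph V E" and "linear_order_on V r"
  shows "acyclic_orientation_poly V E =
    (\<Sum>D\<in>acyclic_orientations E. \<Prod>B\<in>sink_components V r D. block_poly B)"
proof -
  have "{e \<in> E. e \<subseteq> V} = E" using assms(1) by (auto simp: simple_graph_def)
  then show ?thesis
    using sum_prod_sinks_on_eq[of E V r V "var :: 'a \<Rightarrow> 'a int_mpoly"] assms
    by (simp add: simple_graph_def acyclic_on_def acyclic_orientation_poly_def block_poly_def)
qed

end
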